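(* Let $F$ be a free group. (1) If $c=h_1\cdots h_m\ne 1$ in $F$, where $c,h_1,\dots,h_m\in F$ are such that $c$ is a commutator and $h_1,\dots,h_m$ are conjugate to each other in $F$, then $h_1,\dots,h_m$ are all distinct. (2) More generally, if $c_1\cdots c_k=h_1\cdots h_m\ne 1$ in $F$, where $c_1,\dots,c_k,h_1,\dots,h_m\in F$ are such that $c_1,\dots,c_k$ are commutators and $h_1,\dots,h_m$ are conjugate to each other in $F$, then no element occurs in the sequence $h_1,\dots,h_m$ more than $2k-1$ times.
   Context: A commutator is an element of the form $[x,y]=x^{-1}y^{-1}xy$. *)

theory Defs
  imports "HOL-Algebra.Group"
begin

text \<open>
  A word over a set \<open>S\<close> is a list of pairs \<open>(x, b)\<close> with \<open>x \<in> S\<close>; the letter \<open>(x, True)\<close>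
  stands for \<open>x\<close> and \<open>(x, False)\<close> for its formal inverse.
\<close>

definition reduced_word :: "('a \<times> bool) list \<Rightarrow> bool" where
  "reduced_word w \<longleftrightarrow> successively (\<lambda>p q. \<not> (fst p = fst q \<and> snd p \<noteq> snd q)) w"

definition list_prod :: "('a, 'b) monoid_scheme \<Rightarrow> 'a list \<Rightarrow> 'a" where
  "list_prod G xs = foldr (\<otimes>\<^bsub>G\<^esub>) xs \<one>\<^bsub>G\<^esub>"

definition letter_value :: "('a, 'b) monoid_scheme \<Rightarrow> ('s \<Rightarrow> 'a) \<Rightarrow> 's \<times> bool \<Rightarrow> 'a" where
  "letter_value G f p = (if snd p then f (fst p) else inv\<^bsub>G\<^esub> (f (fst p)))"

definition word_value :: "('a, 'b) monoid_scheme \<Rightarrow> ('s \<Rightarrow> 'a) \<Rightarrow> ('s \<times> bool) list \<Rightarrow> 'a" where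
  "word_value G f w = list_prod G (map (letter_value G f) w)"

text \<open>
  A set \<open>S\<close> freely generates \<open>G\<close> if every element of \<open>G\<close> is the value of exactly one reduced
  word over \<open>S\<close>. The universal property, which cannot be used as a definition because it
  quantifies over groups of all types, is derived below.
\<close>

definition free_basis :: "('a, 'b) monoid_scheme \<Rightarrow> 'a set \<Rightarrow> bool" where
  "free_basis G S \<longleftrightarrow> S \<subseteq> carrier G \<and>
     (\<forall>g \<in> carrier G. \<exists>!w. w \<in> lists (S \<times> UNIV) \<and> reduced_word w \<and> word_value G (\<lambda>x. x) w = g)"

definition free_group :: "('a, 'b) monoid_scheme \<Rightarrow> bool" where
  "free_group G \<longleftrightarrow> group G \<and> (\<exists>S. free_basis G S)"

definition is_commutator :: "('a, 'b) monoid_scheme \<Rightarrow> 'a \<Rightarrow> bool" where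
  "is_commutator G c \<longleftrightarrow>
     (\<exists>x \<in> carrier G. \<exists>y \<in> carrier G. c = inv\<^bsub>G\<^esub> x \<otimes>\<^bsub>G\<^esub> inv\<^bsub>G\<^esub> y \<otimes>\<^bsub>G\<^esub> x \<otimes>\<^bsub>G\<^esub> y)"

definition conjugate :: "('a, 'b) monoid_scheme \<Rightarrow> 'a \<Rightarrow> 'a \<Rightarrow> bool" where
  "conjugate G a b \<longleftrightarrow> (\<exists>g \<in> carrier G. b = inv\<^bsub>G\<^esub> g \<otimes>\<^bsub>G\<^esub> a \<otimes>\<^bsub>G\<^esub> g)"

lemma (in group) letter_value_closed:
  "f \<in> S \<rightarrow> carrier G \<Longrightarrow> p \<in> S \<times> UNIV \<Longrightarrow> letter_value G f p \<in> carrier G"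
  by (auto simp: letter_value_def)

lemma word_value_Nil: "word_value G f [] = \<one>\<^bsub>G\<^esub>"
  by (simp add: word_value_def list_prod_def)

lemma word_value_Cons: "word_value G f (p # w) = letter_value G f p \<otimes>\<^bsub>G\<^esub> word_value G f w"
  by (simp add: word_value_def list_prod_def)

lemma (in group) word_value_closed:
  assumes "f \<in> S \<rightarrow> carrier G" "w \<in> lists (S \<times> UNIV)"
  shows "word_value G f w \<in> carrier G"
  using assms(2) by (induction w)
    (auto simp: word_value_Nil word_value_Cons intro!: m_closed letter_value_closed[OF assms(1)])

lemma (in group) word_value_append:
  assumes "f \<in> S \<rightarrow> carrier G" "v \<in> lists (S \<times> UNIV)" "w \<in> lists (S \<times> UNIV)"
  shows "word_value G f (v @ w) = word_value G f v \<otimes> word_value G f w"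
  using assms(2)
proof (induction v)
  case Nil
  then show ?case using word_value_closed[OF assms(1,3)] by (simp add: word_value_Nil)
next
  case (Cons p v)
  then have "letter_value G f p \<in> carrier G" "word_value G f v \<in> carrier G"
    by (auto intro!: letter_value_closed[OF assms(1)] word_value_closed[OF assms(1)])
  with Cons word_value_closed[OF assms(1,3)] show ?case
    by (simp add: word_value_Cons m_assoc)
qed

lemma (in group) word_value_cancel:
  assumes "f \<in> S \<rightarrow> carrier G" "p \<in> S \<times> UNIV" "w \<in> lists (S \<times> UNIV)"
    and "fst p = fst q" "snd p \<noteq> snd q"
  shows "word_value G f (p # q # w) = word_value G f w"
proof -
  have "f (fst p) \<in> carrier G" using assms(1,2) by auto
  with word_value_closed[OF assms(1,3)] assms(4,5) show ?thesis
    by (auto simp: word_value_Cons letter_value_def simp flip: m_assoc)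
qed

lemma exists_reduced_word:
  assumes "group G" "group H" "f \<in> S \<rightarrow> carrier G" "h \<in> S \<rightarrow> carrier H"
    and "w \<in> lists (S \<times> UNIV)"
  shows "\<exists>v \<in> lists (S \<times> UNIV). reduced_word v \<and>
           word_value G f v = word_value G f w \<and> word_value H h v = word_value H h w"
  using assms(5)
proof (induction w)
  case Nil
  then show ?case by (intro bexI[of _ "[]"]) (auto simp: reduced_word_def)
next
  case (Cons p w)
  then obtain v where v: "v \<in> lists (S \<times> UNIV)" "reduced_word v"
    "word_value G f v = word_value G f w" "word_value H h v = word_value H h w"
    by auto
  have eq: "word_value G f (p # v) = word_value G f (p # w)"
    "word_value H h (p # v) = word_value H h (p # w)"
    using v by (simp_all add: word_value_Cons)
  show ?case
  proof (cases "reduced_word (p # v)")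
    case True
    with v eq Cons.hyps show ?thesis by (intro bexI[of _ "p # v"]) auto
  next
    case False
    then obtain q u where u: "v = q # u" "fst p = fst q" "snd p \<noteq> snd q"
      using v(2) by (cases v) (auto simp: reduced_word_def)
    have "u \<in> lists (S \<times> UNIV)" "reduced_word u"
      using v u by (auto simp: reduced_word_def successively_Cons)
    with eq u Cons.hyps show ?thesis
      using group.word_value_cancel[OF assms(1,3) Cons.hyps(1), of u q]
        group.word_value_cancel[OF assms(2,4) Cons.hyps(1), of u q]
      by (intro bexI[of _ u]) auto
  qed
qed

theorem free_basis_universal:
  assumes G: "group G" and S: "free_basis G S" and H: "group H"
    and h: "h \<in> S \<rightarrow> carrier H"
  shows "\<exists>!\<phi>. \<phi> \<in> hom G H \<and> \<phi> \<in> extensional (carrier G) \<and> (\<forall>s \<in> S. \<phi> s = h s)"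
proof -
  interpret G: group G by fact
  interpret H: group H by fact
  let ?v = "word_value G (\<lambda>x. x)" and ?L = "lists (S \<times> (UNIV :: bool set))"
  have id: "(\<lambda>x. x) \<in> S \<rightarrow> carrier G" using S by (auto simp: free_basis_def)
  have ex: "\<exists>!w. w \<in> ?L \<and> reduced_word w \<and> ?v w = g" if "g \<in> carrier G" for g
    using S that by (auto simp: free_basis_def)
  define nf where "nf g = (THE w. w \<in> ?L \<and> reduced_word w \<and> ?v w = g)" for g
  have nf: "nf g \<in> ?L" "reduced_word (nf g)" "?v (nf g) = g" if "g \<in> carrier G" for g
    using theI'[OF ex[OF that]] by (auto simp: nf_def)
  define \<phi> where "\<phi> = restrict (\<lambda>g. word_value H h (nf g)) (carrier G)"
  have val: "\<phi> (?v w) = word_value H h w" if w: "w \<in> ?L" for w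
  proof -
    obtain u where u: "u \<in> ?L" "reduced_word u" "?v u = ?v w" "word_value H h u = word_value H h w"
      using exists_reduced_word[OF G H id h w] by auto
    have c: "?v w \<in> carrier G" by (rule G.word_value_closed[OF id w])
    have "nf (?v w) = u" using ex[OF c] nf[OF c] u by blast
    with u c show ?thesis by (simp add: \<phi>_def)
  qed
  have hom: "\<phi> \<in> hom G H"
  proof (rule homI)
    fix x assume "x \<in> carrier G"
    then show "\<phi> x \<in> carrier H" using H.word_value_closed[OF h nf(1)] by (simp add: \<phi>_def)
  next
    fix x y assume x: "x \<in> carrier G" and y: "y \<in> carrier G"
    have "x \<otimes>\<^bsub>G\<^esub> y = ?v (nf x @ nf y)"
      using G.word_value_append[OF id nf(1)[OF x] nf(1)[OF y]] nf(3) x y by simp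
    also have "\<phi> \<dots> = word_value H h (nf x @ nf y)"
      using nf(1) x y by (intro val) auto
    also have "\<dots> = \<phi> x \<otimes>\<^bsub>H\<^esub> \<phi> y"
      using H.word_value_append[OF h nf(1)[OF x] nf(1)[OF y]] x y by (simp add: \<phi>_def)
    finally show "\<phi> (x \<otimes>\<^bsub>G\<^esub> y) = \<phi> x \<otimes>\<^bsub>H\<^esub> \<phi> y" .
  qed
  have gen: "\<phi> s = h s" if "s \<in> S" for s
  proof -
    have "s \<in> carrier G" "h s \<in> carrier H" using that id h by auto
    then show ?thesis using val[of "[(s, True)]"] that
      by (simp add: word_value_Cons word_value_Nil letter_value_def)
  qed
  have uniq: "\<psi> = \<phi>"
    if \<psi>: "\<psi> \<in> hom G H" "\<psi> \<in> extensional (carrier G)" "\<forall>s \<in> S. \<psi> s = h s" for \<psi>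
  proof -
    interpret \<psi>: group_hom G H \<psi>
      using \<psi>(1) G H by (simp add: group_hom_def group_hom_axioms_def)
    have *: "\<psi> (?v w) = word_value H h w" if "w \<in> ?L" for w
      using that
    proof (induction w)
      case Nil
      then show ?case by (simp add: word_value_Nil)
    next
      case (Cons p w)
      have p: "fst p \<in> S" "fst p \<in> carrier G" using Cons.hyps id by auto
      have "\<psi> (letter_value G (\<lambda>x. x) p) = letter_value H h p"
        using p \<psi>(3) by (auto simp: letter_value_def)
      with Cons show ?case
        using G.letter_value_closed[OF id Cons.hyps(1)] G.word_value_closed[OF id, of w]
        by (simp add: word_value_Cons)
    qed
    show ?thesis
    proof (rule extensionalityI[OF \<psi>(2)])
      show "\<phi> \<in> extensional (carrier G)" by (simp add: \<phi>_def)
      show "\<psi> x = \<phi> x" if "x \<in> carrier G" for x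
        using *[OF nf(1)[OF that]] val[OF nf(1)[OF that]] nf(3)[OF that] by simp
    qed
  qed
  show ?thesis
  proof (rule ex1I[of _ \<phi>])
    show "\<phi> \<in> hom G H \<and> \<phi> \<in> extensional (carrier G) \<and> (\<forall>s \<in> S. \<phi> s = h s)"
      using hom gen by (simp add: \<phi>_def)
  qed (rule uniq; blast)
qed

end

theory Submission imports Defs Complex_Main begin

text \<open>
  Let \<open>F\<close> act on the real line by increasing bijections commuting with \<open>t \<mapsto> t + 1\<close>. A product
  of \<open>k \<ge> 1\<close> commutators moves some point by less than \<open>2 k - 1\<close> (the easy half of a theorem of
  Eisenbud, Hirsch and Neumann). Suppose \<open>h\<close> maps some \<open>q\<close> to \<open>q + 1\<close>. Then every conjugate of
  \<open>h\<close> also translates some point by \<open>1\<close>, hence moves every point to the right, so a product of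
  conjugates of \<open>h\<close> with \<open>r\<close> factors equal to \<open>h\<close> moves \<open>q\<close> by at least \<open>r\<close> and every point by
  more than \<open>r - 1\<close>. Comparing the two bounds gives \<open>r \<le> 2 k - 1\<close>.

  Such an action exists for every \<open>h \<noteq> 1\<close>: conjugate \<open>h\<close> to a cyclically reduced word of length \<open>n\<close>
  and let its letters move \<open>0, 1/n, 2/n, \<dots>\<close> one step each. Since the cyclic word is
  reduced, this prescribes a strictly increasing partial map for every generator, which extends to
  the whole line.
\<close>

section \<open>The group of lifts of orientation-preserving circle homeomorphisms\<close>

definition circle_lifts :: "(real \<Rightarrow> real) monoid" where
  "circle_lifts = \<lparr>carrier = {f. strict_mono f \<and> surj f \<and> (\<forall>t. f (t + 1) = f t + 1)},
     monoid.mult = (\<circ>), one = id\<rparr>"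

lemma circle_lifts_simps [simp]:
  "f \<otimes>\<^bsub>circle_lifts\<^esub> g = f \<circ> g" "\<one>\<^bsub>circle_lifts\<^esub> = id"
  by (simp_all add: circle_lifts_def)

lemma circle_lifts_carrier:
  "f \<in> carrier circle_lifts \<longleftrightarrow> strict_mono f \<and> surj f \<and> (\<forall>t. f (t + 1) = f t + 1)"
  by (simp add: circle_lifts_def)

lemma circle_lifts_le_iff:
  "f \<in> carrier circle_lifts \<Longrightarrow> f s \<le> f t \<longleftrightarrow> s \<le> t"
  by (simp add: circle_lifts_carrier strict_mono_less_eq)

lemma circle_lifts_group: "group circle_lifts"
proof (rule groupI)
  fix f assume f: "f \<in> carrier circle_lifts"
  then have b: "bij f" and m: "strict_mono f" and p: "\<And>t. f (t + 1) = f t + 1"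
    by (auto simp: circle_lifts_carrier bij_def strict_mono_imp_inj_on)
  have fi: "f (inv_into UNIV f t) = t" for t
    using b by (simp add: bij_is_surj surj_f_inv_f)
  have "strict_mono (inv_into UNIV f)"
  proof (rule strict_monoI)
    fix s t :: real assume "s < t"
    then have "f (inv_into UNIV f s) < f (inv_into UNIV f t)" by (simp add: fi)
    then show "inv_into UNIV f s < inv_into UNIV f t" using m by (simp add: strict_mono_less)
  qed
  moreover have "inv_into UNIV f (t + 1) = inv_into UNIV f t + 1" for t
    by (rule inv_f_eq) (use b p fi in \<open>auto simp: bij_is_inj\<close>)
  ultimately have "inv_into UNIV f \<in> carrier circle_lifts"
    using b by (simp add: circle_lifts_carrier bij_is_surj bij_imp_bij_inv)
  moreover have "inv_into UNIV f \<circ> f = id"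
    using b by (simp add: bij_is_inj)
  ultimately show "\<exists>g\<in>carrier circle_lifts. g \<otimes>\<^bsub>circle_lifts\<^esub> f = \<one>\<^bsub>circle_lifts\<^esub>"
    by auto
qed (auto simp: circle_lifts_carrier strict_mono_def comp_surj surj_def, metis)

interpretation lifts: group circle_lifts
  by (rule circle_lifts_group)

lemma circle_lifts_add_int:
  assumes "f \<in> carrier circle_lifts"
  shows "f (t + of_int m) = f t + of_int m"
proof -
  have p: "f (t + 1) = f t + 1" for t
    using assms by (simp add: circle_lifts_carrier)
  have nat: "f (t + of_nat k) = f t + of_nat k" for t k
  proof (induction k)
    case (Suc k)
    then show ?case using p[of "t + of_nat k"] by (simp add: algebra_simps)
  qed simp
  show ?thesis
  proof (cases "m \<ge> 0")
    case True
    then show ?thesis using nat[of t "nat m"] by simp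
  next
    case False
    then show ?thesis using nat[of "t + of_int m" "nat (- m)"] by simp
  qed
qed

lemma lifts_inv_apply:
  assumes "f \<in> carrier circle_lifts" "f s = t"
  shows "(inv\<^bsub>circle_lifts\<^esub> f) t = s"
  using lifts.l_inv[OF assms(1)] assms(2) by (auto simp: fun_eq_iff)

section \<open>Displacement of lifts, of commutators and of products\<close>

text \<open>Some integer translate of \<open>q\<close> lies less than one to the left of
  \<open>t\<close>. It has the same displacement as \<open>q\<close>, and monotonicity carries the
  bound on to \<open>t\<close> at a loss of less than one.\<close>

lemma displacement_gt:
  assumes f: "f \<in> carrier circle_lifts" and q: "q + of_int a \<le> f q"
  shows "t + of_int a - 1 < f t"
proof -
  define m where "m = \<lfloor>t - q\<rfloor>"
  have m: "of_int m \<le> t - q" "t - q < of_int m + 1" by (auto simp: m_def)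
  have "f q + of_int m = f (q + of_int m)" by (simp add: circle_lifts_add_int[OF f])
  also have "\<dots> \<le> f t" using m by (simp add: circle_lifts_le_iff[OF f])
  finally show ?thesis using q m by simp
qed

lemma displacement_lt:
  assumes f: "f \<in> carrier circle_lifts" and q: "f q \<le> q + of_int a"
  shows "f t < t + of_int a + 1"
proof -
  define m where "m = \<lceil>t - q\<rceil>"
  have m: "t - q \<le> of_int m" "of_int m < t - q + 1" unfolding m_def by linarith+
  have "f t \<le> f (q + of_int m)" using m by (simp add: circle_lifts_le_iff[OF f])
  also have "\<dots> = f q + of_int m" by (simp add: circle_lifts_add_int[OF f])
  finally show ?thesis using q m by simp
qed

text \<open>
  Otherwise \<open>f g f\<^sup>-\<^sup>1 \<ge> g + 1\<close> pointwise, so \<open>f g\<^sup>n f\<^sup>-\<^sup>1 \<ge> g\<^sup>n + n\<close>, which is absurd for large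
  \<open>n\<close> because \<open>f\<close> has bounded displacement.
\<close>
lemma commutator_displacement_lt_1:
  assumes "is_commutator circle_lifts c"
  shows "\<exists>t. c t < t + 1"
proof (rule ccontr)
  assume "\<not> ?thesis"
  then have ge: "t + 1 \<le> c t" for t by (simp add: not_less)
  obtain f g where f: "f \<in> carrier circle_lifts" and g: "g \<in> carrier circle_lifts"
    and c: "c = inv\<^bsub>circle_lifts\<^esub> f \<circ> inv\<^bsub>circle_lifts\<^esub> g \<circ> f \<circ> g"
    using assms by (auto simp: is_commutator_def)
  have fi: "f ((inv\<^bsub>circle_lifts\<^esub> f) t) = t" and gi: "g ((inv\<^bsub>circle_lifts\<^esub> g) t) = t" for t
    using lifts.r_inv[OF f] lifts.r_inv[OF g] by (auto simp: fun_eq_iff)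
  have f1: "f (t + of_int m) = f t + of_int m" and g1: "g (t + of_int m) = g t + of_int m" for t m
    using f g by (simp_all add: circle_lifts_add_int)
  \<comment> \<open>Since \<open>c\<close> is the commutator of \<open>f\<close> and
    \<open>g\<close>, one has \<open>f g = g f c\<close>, and \<open>c\<close> moves every point by
    at least one.\<close>
  have step: "g (f t) + 1 \<le> f (g t)" for t
  proof -
    have "g (f t) + 1 = g (f (t + 1))" using f1[of t 1] g1[of "f t" 1] by simp
    also have "\<dots> \<le> g (f (c t))"
      using ge by (simp add: circle_lifts_le_iff[OF f] circle_lifts_le_iff[OF g])
    also have "\<dots> = f (g t)" by (simp add: c fi gi)
    finally show ?thesis .
  qed
  have iter: "(g ^^ n) (f t) + of_nat n \<le> f ((g ^^ n) t)" for n t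
  proof (induction n)
    case (Suc n)
    have "g ((g ^^ n) (f t)) + of_nat n = g ((g ^^ n) (f t) + of_nat n)"
      using g1[of _ "int n"] by simp
    also have "\<dots> \<le> g (f ((g ^^ n) t))" using Suc by (simp add: circle_lifts_le_iff[OF g])
    finally show ?case using step[of "(g ^^ n) t"] by simp
  qed simp
  have pow: "(g ^^ n) \<in> carrier circle_lifts" for n
  proof (induction n)
    case (Suc n)
    show ?case using lifts.m_closed[OF g Suc] by (simp only: funpow.simps circle_lifts_simps)
  qed (use lifts.one_closed in \<open>simp add: id_def\<close>)
  define a b where "a = \<lfloor>f 0\<rfloor>" and "b = \<lceil>f 0\<rceil>"
  have lo: "t + of_int a - 1 < f t" for t
    by (rule displacement_gt[OF f, of 0]) (simp add: a_def)
  have hi: "f t < t + of_int b + 1" for t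
    by (rule displacement_lt[OF f, of 0]) (simp add: b_def)
  \<comment> \<open>The chain below would give \<open>n < b - a + 2\<close>; this is the least value
    contradicting it.\<close>
  define n where "n = nat (b - a + 2)"
  have "a \<le> b" unfolding a_def b_def by linarith
  then have n: "of_nat n = (of_int b - of_int a + 2 :: real)" by (simp add: n_def)
  have "(g ^^ n) 0 + of_int (a - 1) + of_nat n = (g ^^ n) (0 + of_int (a - 1)) + of_nat n"
    by (simp only: circle_lifts_add_int[OF pow])
  also have "\<dots> \<le> (g ^^ n) (f 0) + of_nat n"
    using lo[of 0] by (simp add: circle_lifts_le_iff[OF pow])
  also have "\<dots> \<le> f ((g ^^ n) 0)" by (rule iter)
  also have "\<dots> < (g ^^ n) 0 + of_int b + 1" by (rule hi)
  finally show False using n by simp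
qed

lemma lifts_commutator_closed:
  "is_commutator circle_lifts c \<Longrightarrow> c \<in> carrier circle_lifts"
  by (auto simp: is_commutator_def simp del: circle_lifts_simps)

lemma list_prod_Cons: "list_prod G (x # xs) = x \<otimes>\<^bsub>G\<^esub> list_prod G xs"
  and list_prod_Nil: "list_prod G [] = \<one>\<^bsub>G\<^esub>"
  by (simp_all add: list_prod_def)

lemma (in monoid) list_prod_closed:
  "set xs \<subseteq> carrier G \<Longrightarrow> list_prod G xs \<in> carrier G"
  by (induction xs) (auto simp: list_prod_Cons list_prod_Nil)

lemma (in group_hom) hom_list_prod:
  "set xs \<subseteq> carrier G \<Longrightarrow> h (list_prod G xs) = list_prod H (map h xs)"
  by (induction xs) (auto simp: list_prod_Cons list_prod_Nil G.list_prod_closed)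

text \<open>A commutator moves some point by less than one, hence every point by less than two, and
  these bounds add up along the product.\<close>

lemma commutators_displacement_le:
  assumes "\<forall>c \<in> set cs. is_commutator circle_lifts c"
  shows "list_prod circle_lifts cs t \<le> t + 2 * of_nat (length cs)"
  using assms
proof (induction cs)
  case (Cons c cs)
  have c: "is_commutator circle_lifts c" using Cons.prems by simp
  then obtain s where "c s < s + 1" using commutator_displacement_lt_1 by blast
  then have "c (list_prod circle_lifts cs t) < list_prod circle_lifts cs t + 2"
    using displacement_lt[OF lifts_commutator_closed[OF c], of s 1 "list_prod circle_lifts cs t"] by simp
  with Cons show ?case by (simp add: list_prod_Cons)
qed (simp add: list_prod_Nil)

text \<open>The leftmost factor \<open>c\<close> is controlled at its own good point
  \<open>t\<close>. The other factors cost two each; that total is an integer, so it passes through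
  \<open>c\<close> unchanged, and \<open>c\<close> itself costs less than one.\<close>

lemma commutators_displacement_lt:
  assumes cs: "\<forall>c \<in> set cs. is_commutator circle_lifts c" and "cs \<noteq> []"
  shows "\<exists>t. list_prod circle_lifts cs t < t + 2 * of_nat (length cs) - 1"
proof -
  obtain c ds where ds: "cs = c # ds" using \<open>cs \<noteq> []\<close> by (cases cs) auto
  have c: "is_commutator circle_lifts c" using cs ds by simp
  obtain t where t: "c t < t + 1" using commutator_displacement_lt_1[OF c] by blast
  note cc = lifts_commutator_closed[OF c]
  have "list_prod circle_lifts ds t \<le> t + of_int (2 * int (length ds))"
    using commutators_displacement_le[of ds t] cs ds by simp
  then have "c (list_prod circle_lifts ds t) \<le> c (t + of_int (2 * int (length ds)))"
    by (simp only: circle_lifts_le_iff[OF cc])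
  also have "\<dots> = c t + of_int (2 * int (length ds))" by (rule circle_lifts_add_int[OF cc])
  finally show ?thesis using t by (intro exI[of _ t]) (simp add: ds list_prod_Cons)
qed

text \<open>The lower bound is always an integer translate of \<open>q\<close>, which
  \<open>h\<close> advances by exactly one; no other factor moves a point to the left.\<close>

lemma list_prod_displacement_ge:
  assumes "set fs \<subseteq> carrier circle_lifts" and "\<forall>f \<in> set fs. \<forall>t. t \<le> f t"
    and h: "h \<in> carrier circle_lifts" "h q = q + 1"
  shows "q + of_nat (count_list fs h) \<le> list_prod circle_lifts fs q"
  using assms(1,2)
proof (induction fs)
  case (Cons f fs)
  let ?P = "list_prod circle_lifts fs q"
  have IH: "q + of_nat (count_list fs h) \<le> ?P" using Cons by simp
  show ?case
  proof (cases "f = h")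
    case True
    have "q + of_int (int (count_list fs h)) + 1 = h (q + of_int (int (count_list fs h)))"
      using h by (simp only: circle_lifts_add_int)
    also have "\<dots> \<le> h ?P" using IH by (simp add: circle_lifts_le_iff[OF h(1)])
    finally show ?thesis using True by (simp add: list_prod_Cons)
  next
    case False
    moreover have "?P \<le> f ?P" using Cons.prems by simp
    ultimately show ?thesis using IH by (simp add: list_prod_Cons)
  qed
qed (simp add: list_prod_Nil)

section \<open>Realising words by lifts\<close>

text \<open>
  The extension is \<open>y \<mapsto> inf {k + \<rho> (y - i) | (i, k) \<in> E}\<close>, rescaled by \<open>n\<close>, where \<open>\<rho>\<close> has
  slope \<open>3\<close> on the right of \<open>0\<close> and \<open>1/3\<close> on the left. Positive slopes make it increasing, and it
  extends \<open>E\<close> because \<open>k' - k \<le> \<rho> (i' - i)\<close> for all pairs in \<open>E\<close>.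
\<close>
lemma extend_partial_shift:
  fixes E :: "(int \<times> int) set" and n :: int
  assumes n: "n > 0" and ne: "E \<noteq> {}"
    and per: "\<And>i k. (i, k) \<in> E \<Longrightarrow> (i + n, k + n) \<in> E \<and> (i - n, k - n) \<in> E"
    and near: "\<And>i k. (i, k) \<in> E \<Longrightarrow> \<bar>k - i\<bar> \<le> 1"
    and uniq: "\<And>i k k'. (i, k) \<in> E \<Longrightarrow> (i, k') \<in> E \<Longrightarrow> k = k'"
    and mono: "\<And>i k i' k'. (i, k) \<in> E \<Longrightarrow> (i', k') \<in> E \<Longrightarrow> i < i' \<Longrightarrow> k < k'"
  shows "\<exists>f \<in> carrier circle_lifts. \<forall>(i, k) \<in> E. f (of_int i / of_int n) = of_int k / of_int n"
proof -
  \<comment> \<open>A maximum of linear maps is subadditive, whence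
    \<open>F y - F z \<le> \<rho> (y - z)\<close>. This single estimate gives both Lipschitz
    continuity with constant 3 and growth at rate at least 1/3.\<close>
  define \<rho> :: "real \<Rightarrow> real" where "\<rho> z = max (3 * z) (z / 3)" for z
  have tri: "\<rho> (y + z) \<le> \<rho> y + \<rho> z" for y z by (auto simp: \<rho>_def)
  define V where "V y = (\<lambda>(i, k). of_int k + \<rho> (y - of_int i)) ` E" for y
  define F where "F y = Inf (V y)" for y
  have Vne: "V y \<noteq> {}" for y using ne by (auto simp: V_def)
  have "y - 1 \<le> of_int k + \<rho> (y - of_int i)" if "(i, k) \<in> E" for i k y
  proof -
    have "i - 1 \<le> k" using near[OF that] by linarith
    then have "real_of_int i - 1 \<le> of_int k" by linarith
    then show ?thesis by (auto simp: \<rho>_def max_def field_simps)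
  qed
  then have bdd: "bdd_below (V y)" for y by (intro bdd_belowI[of _ "y - 1"]) (auto simp: V_def)
  have le: "F y \<le> of_int k + \<rho> (y - of_int i)" if "(i, k) \<in> E" for i k y
    unfolding F_def using that bdd by (intro cInf_lower) (auto simp: V_def)
  have ge: "z \<le> F y" if "\<And>i k. (i, k) \<in> E \<Longrightarrow> z \<le> of_int k + \<rho> (y - of_int i)" for y z
    unfolding F_def using that Vne by (intro cInf_greatest) (auto simp: V_def)
  have lip: "F y - F z \<le> \<rho> (y - z)" for y z
  proof -
    have "F y - \<rho> (y - z) \<le> F z"
    proof (rule ge)
      fix i k assume "(i, k) \<in> E"
      then show "F y - \<rho> (y - z) \<le> of_int k + \<rho> (z - of_int i)"
        using le[of i k y] tri[of "y - z" "z - of_int i"] by simp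
    qed
    then show ?thesis by simp
  qed
  have eq: "F (of_int i) = of_int k" if E: "(i, k) \<in> E" for i k
  proof (rule antisym)
    show "F (of_int i) \<le> of_int k" using le[OF E, of "of_int i"] by (simp add: \<rho>_def)
    show "of_int k \<le> F (of_int i)"
    proof (rule ge)
      fix i' k' assume E': "(i', k') \<in> E"
      have near': "k \<le> i + 1" "i' \<le> k' + 1" using near[OF E] near[OF E'] by linarith+
      consider "i' = i" | "i' < i" | "i < i'" by linarith
      \<comment> \<open>The slopes come from here. With shifts of at most one, a gap
        \<open>d \<ge> 1\<close> becomes at most \<open>d + 2 \<le> 3 d\<close> and, by strict
        monotonicity on integers, at least \<open>max 1 (d - 2) \<ge> d / 3\<close>.\<close>
      then have "k - k' \<le> 3 * (i - i') \<or> 3 * (k - k') \<le> i - i'"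
      proof cases
        case 1
        then show ?thesis using uniq[OF E, of k'] E' by simp
      next
        case 2
        then have "k - k' \<le> 3 * (i - i')" unfolding right_diff_distrib using near' by linarith
        then show ?thesis ..
      next
        case 3
        then have "3 * (k - k') \<le> i - i'"
          unfolding right_diff_distrib using near' mono[OF E E'] by linarith
        then show ?thesis ..
      qed
      then have "real_of_int (k - k') \<le> of_int (3 * (i - i')) \<or>
          real_of_int (3 * (k - k')) \<le> of_int (i - i')"
        by (simp only: of_int_le_iff)
      then have "real_of_int k - of_int k' \<le> \<rho> (of_int i - of_int i')"
        by (auto simp: \<rho>_def le_max_iff_disj)
      then show "of_int k \<le> of_int k' + \<rho> (of_int i - of_int i')" by simp
    qed
  qed
  have Fper: "F (y + of_int n) = F y + of_int n" for y
  proof (rule antisym)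
    have "F (y + of_int n) - of_int n \<le> F y"
    proof (rule ge)
      fix i k assume "(i, k) \<in> E"
      then show "F (y + of_int n) - of_int n \<le> of_int k + \<rho> (y - of_int i)"
        using le[of "i + n" "k + n" "y + of_int n"] per by (simp add: algebra_simps)
    qed
    then show "F (y + of_int n) \<le> F y + of_int n" by simp
    show "F y + of_int n \<le> F (y + of_int n)"
    proof (rule ge)
      fix i k assume "(i, k) \<in> E"
      then show "F y + of_int n \<le> of_int k + \<rho> (y + of_int n - of_int i)"
        using le[of "i - n" "k - n" y] per by (simp add: algebra_simps)
    qed
  qed
  have grow: "z - y \<le> 3 * F z - 3 * F y" if "y \<le> z" for y z
  proof -
    have "\<rho> (y - z) = (y - z) / 3" using that by (simp add: \<rho>_def max_def)
    then show ?thesis using lip[of y z] by (simp add: field_simps)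
  qed
  have F_less: "F y < F z" if "y < z" for y z
    using grow[OF less_imp_le[OF that]] that by linarith
  have cont: "isCont F y" for y
  proof -
    have "\<rho> z \<le> 3 * \<bar>z\<bar>" for z unfolding \<rho>_def by (rule max.boundedI) linarith+
    then have *: "F w - F z \<le> 3 * \<bar>w - z\<bar>" for w z using lip order_trans by blast
    have "dist (F z) (F y) \<le> dist (3 * z) (3 * y)" for z
    proof -
      have "\<bar>F z - F y\<bar> \<le> 3 * \<bar>z - y\<bar>"
        unfolding abs_le_iff using *[of z y] *[of y z, unfolded abs_minus_commute[of y z]] by simp
      also have "\<dots> = \<bar>3 * (z - y)\<bar>" by (simp only: abs_mult abs_numeral)
      finally show ?thesis by (simp add: dist_real_def)
    qed
    then have "\<forall>\<^sub>F z in at y. dist (F z) (F y) \<le> dist (3 * z) (3 * y)"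
      by (rule always_eventually[OF allI])
    moreover have "((\<lambda>z. 3 * z) \<longlongrightarrow> 3 * y) (at y)" by (intro tendsto_intros)
    ultimately show ?thesis
      unfolding isCont_def by (rule metric_tendsto_imp_tendsto[rotated])
  qed
  have surj: "\<exists>y. F y = v" for v
  proof -
    \<comment> \<open>Growth at rate at least 1/3 over a distance \<open>b\<close> on either side of
      0 suffices to reach \<open>v\<close>.\<close>
    define b where "b = 3 * \<bar>v - F 0\<bar>"
    have b: "3 * F 0 - 3 * v \<le> b" "3 * v - 3 * F 0 \<le> b" "0 \<le> b"
      by (auto simp: b_def abs_if)
    have "b \<le> 3 * F 0 - 3 * F (- b)" "b \<le> 3 * F b - 3 * F 0"
      using grow[of "- b" 0] grow[of 0 b] b(3) by simp_all
    then have "F (- b) \<le> v" "v \<le> F b" "- b \<le> b" using b by linarith+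
    then obtain y where "F y = v" using IVT[of F "- b" v b] cont by metis
    then show ?thesis ..
  qed
  define f where "f t = F (of_int n * t) / of_int n" for t
  have "strict_mono f"
  proof (rule strict_monoI)
    fix s t :: real assume "s < t"
    then have "of_int n * s < of_int n * t" using n by simp
    then have "F (of_int n * s) < F (of_int n * t)" by (rule F_less)
    then show "f s < f t" using n by (simp add: f_def divide_strict_right_mono)
  qed
  moreover have "\<exists>t. v = f t" for v
  proof -
    obtain y where "F y = of_int n * v" using surj by blast
    then have "v = f (y / of_int n)" using n by (simp add: f_def)
    then show ?thesis by blast
  qed
  then have "surj f" by (simp add: surj_def)
  moreover have "f (t + 1) = f t + 1" for t
    using n Fper[of "of_int n * t"] by (simp add: f_def field_simps)
  moreover have "f (of_int i / of_int n) = of_int k / of_int n" if "(i, k) \<in> E" for i k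
    using eq[OF that] n by (simp add: f_def)
  ultimately show ?thesis
    by (intro bexI[of _ f]) (auto simp: circle_lifts_carrier)
qed

text \<open>
  Reducedness makes the partial map of each generator on \<open>(1/n)\<int>\<close>, prescribed by its occurrences
  in \<open>s\<close>, strictly monotone.
\<close>
lemma periodic_word_action:
  fixes s :: "int \<Rightarrow> 's \<times> bool" and n :: int
  assumes n: "n > 0" and per: "\<And>j. s (j + n) = s j"
    and red: "\<And>j. fst (s j) = fst (s (j + 1)) \<Longrightarrow> snd (s j) = snd (s (j + 1))"
  shows "\<exists>h. (\<forall>a. h a \<in> carrier circle_lifts) \<and>
    (\<forall>j. letter_value circle_lifts h (s j) (of_int j / of_int n) = of_int (j + 1) / of_int n)"
proof -
  have per': "s (j - n) = s j" for j using per[of "j - n"] by simp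
  have clash: "s (j + 1) \<noteq> (a, \<not> e)" if "s j = (a, e)" for j a e
    using red[of j] that by auto
  have "\<exists>f \<in> carrier circle_lifts. \<forall>j.
      (s j = (a, True) \<longrightarrow> f (of_int j / of_int n) = of_int (j + 1) / of_int n) \<and>
      (s j = (a, False) \<longrightarrow> f (of_int (j + 1) / of_int n) = of_int j / of_int n)" for a
  proof -
    \<comment> \<open>Every letter has to move \<open>j\<close> to \<open>j + 1\<close>. An inverse
      letter does so when the generator itself moves \<open>j + 1\<close> to
      \<open>j\<close>.\<close>
    define E where "E = {(j, j + 1) | j. s j = (a, True)} \<union> {(j + 1, j) | j. s j = (a, False)}"
    have E: "(i, k) \<in> E \<longleftrightarrow> k = i + 1 \<and> s i = (a, True) \<or> k = i - 1 \<and> s (i - 1) = (a, False)" for i k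
      by (auto simp: E_def)
    show ?thesis
    proof (cases "E = {}")
      \<comment> \<open>A generator that does not occur in \<open>s\<close> is unconstrained and
        acts as the identity.\<close>
      case True
      then have "s j \<noteq> (a, e)" for j e by (cases e) (auto simp: E_def)
      then show ?thesis using lifts.one_closed by blast
    next
      case False
      have "\<exists>f \<in> carrier circle_lifts. \<forall>(i, k) \<in> E. f (of_int i / of_int n) = of_int k / of_int n"
      proof (rule extend_partial_shift[OF n False])
        fix i k assume "(i, k) \<in> E"
        then show "(i + n, k + n) \<in> E \<and> (i - n, k - n) \<in> E"
          using per[of i] per[of "i - 1"] per'[of i] per'[of "i - 1"]
          by (auto simp: E algebra_simps)
      next
        fix i k assume "(i, k) \<in> E"
        then show "\<bar>k - i\<bar> \<le> 1" by (auto simp: E)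
      next
        fix i k k' assume "(i, k) \<in> E" "(i, k') \<in> E"
        then show "k = k'" using clash[of "i - 1" a False] by (auto simp: E)
      next
        fix i k i' k' assume *: "(i, k) \<in> E" "(i', k') \<in> E" "i < i'"
        show "k < k'"
        proof (rule ccontr)
          assume "\<not> k < k'"
          \<comment> \<open>Order can fail only if \<open>i\<close> moves right, \<open>i'\<close>
            moves left and they are at most two apart. Then \<open>s i\<close> would carry both
            signs, or the letters at \<open>i\<close> and \<open>i + 1\<close> would cancel.\<close>
          with * have "k = i + 1" "s i = (a, True)" "s (i' - 1) = (a, False)" "i' = i + 1 \<or> i' = i + 2"
            by (auto simp: E)
          then show False using clash[of i a True] by (auto simp: add.commute)
        qed
      qed
      then obtain f where f: "f \<in> carrier circle_lifts"
        "\<And>i k. (i, k) \<in> E \<Longrightarrow> f (of_int i / of_int n) = of_int k / of_int n"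
        by auto
      show ?thesis
      proof (intro bexI[of _ f] allI conjI impI)
        fix j assume "s j = (a, True)"
        then show "f (of_int j / of_int n) = of_int (j + 1) / of_int n" by (intro f) (simp add: E)
      next
        fix j assume "s j = (a, False)"
        then show "f (of_int (j + 1) / of_int n) = of_int j / of_int n" by (intro f) (simp add: E)
      qed (rule f)
    qed
  qed
  then obtain h where h: "\<And>a. h a \<in> carrier circle_lifts"
    "\<And>a j. s j = (a, True) \<Longrightarrow> h a (of_int j / of_int n) = of_int (j + 1) / of_int n"
    "\<And>a j. s j = (a, False) \<Longrightarrow> h a (of_int (j + 1) / of_int n) = of_int j / of_int n"
    by metis
  have "letter_value circle_lifts h (s j) (of_int j / of_int n) = of_int (j + 1) / of_int n" for j
    using h(2)[of j "fst (s j)"] lifts_inv_apply[OF h(1) h(3)[of j "fst (s j)"]]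
    by (cases "s j"; cases "snd (s j)") (auto simp: letter_value_def)
  with h(1) show ?thesis by blast
qed

section \<open>Cyclically reduced words\<close>

definition cyclically_reduced :: "('a \<times> bool) list \<Rightarrow> bool" where
  "cyclically_reduced w \<longleftrightarrow> (\<forall>i < length w.
     fst (w ! i) = fst (w ! (Suc i mod length w)) \<longrightarrow> snd (w ! i) = snd (w ! (Suc i mod length w)))"

text \<open>The bi-infinite repetition of \<open>w\<close> has no cancelling neighbours, even across
  the seams, so its letters can act as steps of length \<open>1/n\<close>; the \<open>n\<close>
  letters of \<open>w\<close> cover the way from -1 to 0.\<close>

lemma cyclically_reduced_word_action:
  assumes w: "w \<noteq> []" and red: "cyclically_reduced w"
  shows "\<exists>h. (\<forall>a. h a \<in> carrier circle_lifts) \<and> word_value circle_lifts h w (-1) = 0"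
proof -
  define n where "n = length w"
  have n: "n > 0" using w by (simp add: n_def)
  \<comment> \<open>The last letter acts first, whence the reversal.\<close>
  define s where "s j = w ! nat ((- 1 - j) mod int n)" for j
  have "s (j + int n) = s j" for j
    by (simp add: s_def) (metis diff_diff_eq minus_mod_self2 diff_add_eq_diff_diff_swap)
  moreover have "snd (s j) = snd (s (j + 1))" if "fst (s j) = fst (s (j + 1))" for j
  proof -
    \<comment> \<open>As \<open>s\<close> runs backwards through \<open>w\<close>, the cyclic
      successor of the letter at \<open>j + 1\<close> is the letter at \<open>j\<close>.\<close>
    define i where "i = nat ((- 1 - (j + 1)) mod int n)"
    have i: "i < n" "int i = (- 1 - (j + 1)) mod int n" using n by (auto simp: i_def nat_less_iff)
    have "int (Suc i mod n) = (- 1 - j) mod int n"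
      using i(2) by (simp add: zmod_int mod_simps algebra_simps)
    then have "s j = w ! (Suc i mod n)" by (metis s_def nat_int)
    moreover have "s (j + 1) = w ! i" by (simp add: s_def i_def)
    ultimately show ?thesis using red i(1) that by (auto simp: cyclically_reduced_def n_def)
  qed
  ultimately obtain h where h: "\<And>a. h a \<in> carrier circle_lifts"
    "\<And>j. letter_value circle_lifts h (s j) (of_int j / of_int n) = of_int (j + 1) / of_int n"
    using periodic_word_action[of "int n" s] n by (metis of_nat_0_less_iff of_int_of_nat_eq)
  have "word_value circle_lifts h (drop (n - k) w) (-1) = of_nat k / of_nat n - 1" if "k \<le> n" for k
    using that
  proof (induction k)
    case 0
    then show ?case by (simp add: n_def word_value_Nil)
  next
    case (Suc k)
    \<comment> \<open>The last \<open>k\<close> letters have moved -1 to \<open>?j / n\<close>, and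
      the next letter to the left is the one \<open>s\<close> assigns to \<open>?j\<close>.\<close>
    let ?i = "n - Suc k" and ?j = "int k - int n"
    have d: "drop ?i w = w ! ?i # drop (n - k) w"
      using Suc.prems by (metis Cons_nth_drop_Suc Suc_diff_Suc Suc_le_lessD diff_less n n_def zero_less_Suc)
    have "(- 1 - ?j) mod int n = int ?i"
      using Suc.prems by (simp add: of_nat_diff)
    then have s: "s ?j = w ! ?i" by (simp add: s_def)
    have "real k / real n - 1 = of_int ?j / of_int (int n)" using n by (simp add: field_simps)
    moreover have "of_int (?j + 1) / of_int (int n) = real (Suc k) / real n - 1"
      using n by (simp add: field_simps)
    ultimately show ?case using Suc h(2)[of ?j] by (simp add: d s word_value_Cons)
  qed
  from this[of n] n h(1) show ?thesis by (intro exI[of _ h]) simp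
qed

text \<open>A shortest word with value conjugate to that of \<open>v\<close> works: a cyclically
  adjacent cancelling pair could be rotated to the front and deleted.\<close>

lemma (in group) conjugate_to_cyclically_reduced:
  assumes f: "f \<in> S \<rightarrow> carrier G" and v: "v \<in> lists (S \<times> UNIV)"
  shows "\<exists>w \<in> lists (S \<times> UNIV). cyclically_reduced w \<and>
    conjugate G (word_value G f v) (word_value G f w)"
proof -
  define W where "W w \<longleftrightarrow> w \<in> lists (S \<times> UNIV) \<and>
    conjugate G (word_value G f v) (word_value G f w)" for w
  have val: "word_value G f u \<in> carrier G" if "u \<in> lists (S \<times> UNIV)" for u
    by (rule word_value_closed[OF f that])
  \<comment> \<open>Moving the first letter to the end conjugates the value by that letter.\<close>
  have rot1: "W (rotate1 u)" if u: "W u" for u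
  proof (cases u)
    case (Cons p u')
    have l: "p \<in> S \<times> UNIV" "u' \<in> lists (S \<times> UNIV)" using u Cons by (auto simp: W_def)
    have p: "letter_value G f p \<in> carrier G" by (rule letter_value_closed[OF f l(1)])
    obtain g where g: "g \<in> carrier G" "word_value G f u = inv g \<otimes> word_value G f v \<otimes> g"
      using u by (auto simp: W_def conjugate_def)
    let ?l = "letter_value G f p" and ?v = "word_value G f v" and ?u = "word_value G f u'"
    have "?u = inv ?l \<otimes> word_value G f u"
      using p val[OF l(2)] by (simp add: Cons word_value_Cons flip: m_assoc)
    moreover have "word_value G f (u' @ [p]) = ?u \<otimes> ?l"
      using word_value_append[OF f l(2), of "[p]"] l p by (simp add: word_value_Cons word_value_Nil)
    ultimately have "word_value G f (u' @ [p]) = inv (g \<otimes> ?l) \<otimes> ?v \<otimes> (g \<otimes> ?l)"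
      using g p val[OF v] by (simp add: inv_mult_group m_assoc)
    then show ?thesis using Cons l g p by (auto simp: W_def conjugate_def)
  qed (use u in simp)
  have rot: "W (rotate m u)" if "W u" for m u
    using that by (induction m) (simp_all add: rot1)
  have "W v" using v val[OF v] by (auto simp: W_def conjugate_def intro!: bexI[of _ \<one>])
  then obtain w where w: "W w" and min: "\<And>u. W u \<Longrightarrow> length w \<le> length u"
    using ex_has_least_nat[of W v length] by auto
  have "snd (w ! i) = snd (w ! (Suc i mod length w))"
    if i: "i < length w" and eq: "fst (w ! i) = fst (w ! (Suc i mod length w))" for i
  proof (rule ccontr)
    assume ne: "snd (w ! i) \<noteq> snd (w ! (Suc i mod length w))"
    \<comment> \<open>In a one-letter word the letter is its own cyclic neighbour, so the signs
      cannot differ.\<close>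
    have len: "2 \<le> length w"
    proof (rule ccontr)
      assume "\<not> 2 \<le> length w"
      then have "length w = 1" "i = 0" using i by linarith+
      then have "Suc i mod length w = i" by simp
      with ne show False by simp
    qed
    have "2 \<le> length (rotate i w)" using len by simp
    then obtain p q u where r: "rotate i w = p # q # u"
      by (metis Suc_le_length_iff numeral_2_eq_2)
    have p: "p = w ! i" using nth_rotate[of 0 w i] i len r by (cases w) simp_all
    have q: "q = w ! (Suc i mod length w)" using nth_rotate[of 1 w i] len r by simp
    have W: "W (p # q # u)" using rot[OF w, of i] by (simp only: r)
    then have l: "p \<in> S \<times> UNIV" "u \<in> lists (S \<times> UNIV)" by (simp_all add: W_def)
    have "word_value G f (p # q # u) = word_value G f u"
      by (rule word_value_cancel[OF f l]) (use eq ne p q in simp_all)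
    then have "W u" using W l(2) by (simp add: W_def)
    moreover have "length w = Suc (Suc (length u))"
      using length_rotate[of i w] by (simp add: r del: length_rotate)
    ultimately show False using min[of u] by simp
  qed
  then show ?thesis using w by (auto simp: W_def cyclically_reduced_def)
qed

section \<open>Transfer along homomorphisms and conjugation\<close>

lemma (in group_hom) hom_word_value:
  assumes "f \<in> S \<rightarrow> carrier G" "w \<in> lists (S \<times> UNIV)"
  shows "h (word_value G f w) = word_value H (\<lambda>s. h (f s)) w"
  using assms(2)
proof (induction w)
  case (Cons p w)
  then have "f (fst p) \<in> carrier G" using assms(1) by auto
  then have "h (letter_value G f p) = letter_value H (\<lambda>s. h (f s)) p"
    by (simp add: letter_value_def)
  with Cons show ?case
    using G.letter_value_closed[OF assms(1) Cons.hyps(1)] G.word_value_closed[OF assms(1), of w]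
    by (simp add: word_value_Cons)
qed (simp add: word_value_Nil)

lemma word_value_cong:
  assumes "w \<in> lists (S \<times> UNIV)" "\<And>s. s \<in> S \<Longrightarrow> f s = g s"
  shows "word_value G f w = word_value G g w"
  using assms(1) by (induction w) (auto simp: word_value_Nil word_value_Cons letter_value_def assms(2))

lemma (in group_hom) hom_conjugate:
  assumes "conjugate G a b" "a \<in> carrier G"
  shows "conjugate H (h a) (h b)"
proof -
  obtain g where "g \<in> carrier G" "b = inv g \<otimes> a \<otimes> g"
    using assms(1) by (auto simp: conjugate_def)
  then show ?thesis unfolding conjugate_def
    using assms(2) by (intro bexI[of _ "h g"]) auto
qed

lemma (in group_hom) hom_commutator:
  assumes "is_commutator G c"
  shows "is_commutator H (h c)"
proof -
  obtain x y where "x \<in> carrier G" "y \<in> carrier G" "c = inv x \<otimes> inv y \<otimes> x \<otimes> y"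
    using assms by (auto simp: is_commutator_def)
  then show ?thesis unfolding is_commutator_def
    by (intro bexI[of _ "h x"] bexI[of _ "h y"]) auto
qed

lemma (in group) conjugate_sym:
  assumes "conjugate G a b" "a \<in> carrier G"
  shows "conjugate G b a"
proof -
  obtain g where g: "g \<in> carrier G" "b = inv g \<otimes> a \<otimes> g"
    using assms by (auto simp: conjugate_def)
  have "g \<otimes> b = a \<otimes> g"
    using g assms(2) by (simp flip: m_assoc)
  then have "inv (inv g) \<otimes> b \<otimes> inv g = a"
    using g(1) assms(2) by (simp add: m_assoc)
  then show ?thesis unfolding conjugate_def
    using g(1) by (intro bexI[of _ "inv g"]) auto
qed

text \<open>The conjugator commutes with the unit translation, so its inverse takes \<open>q\<close>
  to a point that is again translated by one.\<close>

lemma conjugate_translates_point: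
  assumes "conjugate circle_lifts f g" "f \<in> carrier circle_lifts" "f q = q + 1"
  shows "\<exists>q'. g q' = q' + 1"
proof -
  obtain k where k: "k \<in> carrier circle_lifts" "g = inv\<^bsub>circle_lifts\<^esub> k \<circ> f \<circ> k"
    using assms(1) by (auto simp: conjugate_def)
  define q' where "q' = (inv\<^bsub>circle_lifts\<^esub> k) q"
  have q': "k q' = q" using lifts.r_inv[OF k(1)] by (auto simp: fun_eq_iff q'_def)
  have "k (q' + 1) = q + 1" using k(1) q' by (simp add: circle_lifts_carrier)
  then have "g q' = q' + 1" using q' assms(3) k lifts_inv_apply by simp
  then show ?thesis ..
qed

section \<open>Counting repeated conjugates in a free group\<close>

lemma free_group_lifts_hom:
  assumes F: "free_group F" and x: "x \<in> carrier F" "x \<noteq> \<one>\<^bsub>F\<^esub>"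
  shows "\<exists>\<phi> \<in> hom F circle_lifts. \<exists>q. \<phi> x q = q + 1"
proof -
  interpret F: group F using F by (simp add: free_group_def)
  obtain S where S: "free_basis F S" using F by (auto simp: free_group_def)
  have id: "(\<lambda>s. s) \<in> S \<rightarrow> carrier F" using S by (auto simp: free_basis_def)
  obtain v where v: "v \<in> lists (S \<times> UNIV)" "word_value F (\<lambda>s. s) v = x"
    using S x(1) unfolding free_basis_def by blast
  obtain w where w: "w \<in> lists (S \<times> UNIV)" "cyclically_reduced w"
    "conjugate F x (word_value F (\<lambda>s. s) w)"
    using F.conjugate_to_cyclically_reduced[OF id v(1)] v(2) by auto
  let ?y = "word_value F (\<lambda>s. s) w"
  have y: "?y \<in> carrier F" by (rule F.word_value_closed[OF id w(1)])
  have yx: "conjugate F ?y x" using F.conjugate_sym[OF w(3) x(1)] .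
  \<comment> \<open>An empty word would make \<open>x\<close> a conjugate of the identity.\<close>
  have "w \<noteq> []"
  proof
    assume "w = []"
    then have "x = \<one>\<^bsub>F\<^esub>" using yx by (auto simp: conjugate_def word_value_Nil)
    with x(2) show False ..
  qed
  then obtain h where h: "\<And>a. h a \<in> carrier circle_lifts" "word_value circle_lifts h w (-1) = 0"
    using cyclically_reduced_word_action[OF _ w(2)] by blast
  obtain \<phi> where \<phi>: "\<phi> \<in> hom F circle_lifts" "\<forall>s \<in> S. \<phi> s = h s"
    using free_basis_universal[OF F.is_group S circle_lifts_group, of h] h(1) by blast
  interpret \<phi>: group_hom F circle_lifts \<phi>
    using \<phi>(1) by (simp add: group_hom_def group_hom_axioms_def F.is_group circle_lifts_group)
  have "\<phi> ?y = word_value circle_lifts h w"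
    using \<phi>.hom_word_value[OF id w(1)] word_value_cong[OF w(1), of \<phi> h] \<phi>(2) by simp
  then have "\<phi> ?y (-1) = -1 + 1" using h(2) by simp
  then have "\<exists>q. \<phi> x q = q + 1"
    by (rule conjugate_translates_point[OF \<phi>.hom_conjugate[OF yx y] \<phi>.hom_closed[OF y]])
  with \<phi>(1) show ?thesis by blast
qed

lemma count_conjugates_le:
  assumes F: "free_group F" and hs: "set hs \<subseteq> carrier F" and cs: "set cs \<subseteq> carrier F"
    and eq: "list_prod F cs = list_prod F hs" and ne: "list_prod F hs \<noteq> \<one>\<^bsub>F\<^esub>"
    and comm: "\<forall>c \<in> set cs. is_commutator F c"
    and conj: "\<forall>a \<in> set hs. \<forall>b \<in> set hs. conjugate F a b"
  shows "count_list hs h \<le> 2 * length cs - 1"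
proof (cases "h \<in> set hs")
  case True
  interpret F: group F using F by (simp add: free_group_def)
  have hF: "h \<in> carrier F" using True hs by auto
  have "h \<noteq> \<one>\<^bsub>F\<^esub>"
  proof
    assume "h = \<one>\<^bsub>F\<^esub>"
    have "b = \<one>\<^bsub>F\<^esub>" if "b \<in> set hs" for b
    proof -
      have "conjugate F \<one>\<^bsub>F\<^esub> b" using conj True that \<open>h = \<one>\<^bsub>F\<^esub>\<close> by blast
      then show ?thesis by (auto simp: conjugate_def)
    qed
    then have "set hs \<subseteq> {\<one>\<^bsub>F\<^esub>}" by blast
    then have "list_prod F hs = \<one>\<^bsub>F\<^esub>"
      by (induction hs) (simp_all add: list_prod_Cons list_prod_Nil)
    with ne show False ..
  qed
  then obtain \<phi> q where \<phi>: "\<phi> \<in> hom F circle_lifts" and q: "\<phi> h q = q + 1"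
    using free_group_lifts_hom[OF F hF] by blast
  interpret \<phi>: group_hom F circle_lifts \<phi>
    using \<phi> by (simp add: group_hom_def group_hom_axioms_def F.is_group circle_lifts_group)
  let ?fs = "map \<phi> hs" and ?P = "list_prod circle_lifts (map \<phi> hs)"
  have fs: "set ?fs \<subseteq> carrier circle_lifts" using hs by auto
  have "t \<le> f t" if f: "f \<in> set ?fs" for f t
  proof -
    obtain b where b: "b \<in> set hs" "f = \<phi> b" using f by auto
    then have "conjugate F h b" using conj True by blast
    then have "conjugate circle_lifts (\<phi> h) f"
      unfolding b(2) by (rule \<phi>.hom_conjugate[OF _ hF])
    then obtain q' where "f q' = q' + 1"
      using conjugate_translates_point[OF _ \<phi>.hom_closed[OF hF] q] by blast
    moreover have "f \<in> carrier circle_lifts" using f fs by blast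
    ultimately show ?thesis using displacement_gt[of f q' 1 t] by simp
  qed
  then have "q + of_nat (count_list ?fs (\<phi> h)) \<le> ?P q"
    using list_prod_displacement_ge[OF fs _ \<phi>.hom_closed[OF hF] q] by blast
  \<comment> \<open>The homomorphism may identify different entries, so the count can only grow,
    which is the harmless direction.\<close>
  moreover have "count_list hs h \<le> count_list ?fs (\<phi> h)" by (induction hs) auto
  ultimately have "q + of_int (int (count_list hs h)) \<le> ?P q" by simp
  then have lower: "t + of_nat (count_list hs h) - 1 < ?P t" for t
    using displacement_gt[OF lifts.list_prod_closed[OF fs], of q "int (count_list hs h)" t] by simp
  have commH: "\<forall>c \<in> set (map \<phi> cs). is_commutator circle_lifts c"
    using comm \<phi>.hom_commutator by simp
  \<comment> \<open>A nontrivial product needs at least one commutator, so the sharper bound applies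
    and \<open>2 * length cs - 1\<close> is not truncated.\<close>
  have "cs \<noteq> []" using eq ne by (auto simp: list_prod_Nil)
  then obtain t where "list_prod circle_lifts (map \<phi> cs) t < t + 2 * of_nat (length cs) - 1"
    using commutators_displacement_lt[of "map \<phi> cs"] commH by auto
  moreover have "list_prod circle_lifts (map \<phi> cs) = ?P"
    using eq \<phi>.hom_list_prod[OF hs] \<phi>.hom_list_prod[OF cs] by simp
  \<comment> \<open>The displacement at \<open>t\<close> is more than the count minus one and less
    than \<open>2 k - 1\<close> with \<open>k = length cs\<close>; integrality then gives the
    claim.\<close>
  ultimately have "real (count_list hs h) < 2 * real (length cs)" using lower[of t] by simp
  then show ?thesis by linarith
qed (simp add: count_list_0_iff)

theorem corollary3:
  fixes F :: "('a, 'b) monoid_scheme"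
  assumes "free_group F"
  shows
    "(\<forall>c hs. c \<in> carrier F \<and> set hs \<subseteq> carrier F \<and>
        c = list_prod F hs \<and> list_prod F hs \<noteq> \<one>\<^bsub>F\<^esub> \<and>
        is_commutator F c \<and> (\<forall>a \<in> set hs. \<forall>b \<in> set hs. conjugate F a b)
        \<longrightarrow> distinct hs) \<and>
     (\<forall>cs hs. set cs \<subseteq> carrier F \<and> set hs \<subseteq> carrier F \<and>
        list_prod F cs = list_prod F hs \<and> list_prod F hs \<noteq> \<one>\<^bsub>F\<^esub> \<and>
        (\<forall>c \<in> set cs. is_commutator F c) \<and> (\<forall>a \<in> set hs. \<forall>b \<in> set hs. conjugate F a b)
        \<longrightarrow> (\<forall>h. count_list hs h \<le> 2 * length cs - 1))"
proof (intro conjI allI impI; elim conjE)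
  fix cs hs h
  assume "set cs \<subseteq> carrier F" "set hs \<subseteq> carrier F" "list_prod F cs = list_prod F hs"
    "list_prod F hs \<noteq> \<one>\<^bsub>F\<^esub>" "\<forall>c \<in> set cs. is_commutator F c"
    "\<forall>a \<in> set hs. \<forall>b \<in> set hs. conjugate F a b"
  then show "count_list hs h \<le> 2 * length cs - 1"
    by (intro count_conjugates_le[OF assms])
next
  interpret group F using assms by (simp add: free_group_def)
  fix c hs
  assume c: "c \<in> carrier F" "is_commutator F c" "c = list_prod F hs"
    and hs: "set hs \<subseteq> carrier F" "list_prod F hs \<noteq> \<one>\<^bsub>F\<^esub>"
      "\<forall>a \<in> set hs. \<forall>b \<in> set hs. conjugate F a b"
  have "list_prod F [c] = c"
    using c(1) by (simp add: list_prod_Cons list_prod_Nil)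
  \<comment> \<open>A single commutator is the case \<open>k = 1\<close>, where the bound
    \<open>2 k - 1\<close> is one and excludes repetitions.\<close>
  then have c': "list_prod F [c] = list_prod F hs" using c(3) by (rule trans)
  have "count_list hs h \<le> 2 * length [c] - 1" for h
    by (rule count_conjugates_le[OF assms hs(1) _ c' hs(2) _ hs(3)]) (use c(1,2) in simp_all)
  then have le: "count_list hs h \<le> 1" for h by simp
  show "distinct hs"
    using le
  proof (induction hs)
    case (Cons a hs)
    have "count_list hs h \<le> 1" for h
      using Cons.prems[of h] by (cases "h = a") simp_all
    then have "distinct hs" by (rule Cons.IH)
    moreover have "count_list hs a = 0" using Cons.prems[of a] by simp
    then have "a \<notin> set hs" by (simp only: count_list_0_iff not_False_eq_True)
    ultimately show ?case by simp
  qed simp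
qed

end
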